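(* Let $\rho,\sigma>0$ be fixed, and let $(z,w)\in\mathcal E$, $z,w>0$, be the unique pair satisfying $$\ln\Big(\frac zu\Big)\big(\rho-\rho(\bar c^{z,w})\big)+\ln\Big(\frac wv\Big)\big(\sigma-\sigma(\bar c^{z,w})\big)\ge0\quad\text{for all } u,v>0\text{ with }(u,v)\in\mathcal E.$$ Then $$\inf_{c\in X^+_{\rho,\sigma}}H[c|\bar c^{z,w}]=0.$$
   Context: $\Omega=\{(r,s)\in\mathbb N_0^2 : r+s\ge1\}$, and $Q_{r,s}>0$, $(r,s)\in\Omega$, are given positive numbers with $Q_{1,0}=Q_{0,1}=1$. For $z,w\ge0$ let $\bar c^{z,w}_{r,s}=z^rw^sQ_{r,s}$. For a nonnegative sequence $c$ on $\Omega$, $\rho(c)=\sum_{(r,s)\in\Omega}r\,c_{r,s}$ and $\sigma(c)=\sum_{(r,s)\in\Omega}s\,c_{r,s}$. The region of existence is $\mathcal E=\{(z,w): z\ge0,\ w\ge0,\ \rho(\bar c^{z,w})+\sigma(\bar c^{z,w})<\infty\}$; it is assumed to contain a pair with both entries positive. (Under this assumption the pair $(z,w)$ in the claim is known to exist and be unique.) $X^+$ is the set of nonnegative sequences $c=(c_{r,s})_{(r,s)\in\Omega}$ with $\sum_{(r,s)\in\Omega}(r+s)c_{r,s}<\infty$, and $X^+_{\rho,\sigma}=\{c\in X^+: \rho(c)=\rho,\ \sigma(c)=\sigma\}$. For $z,w>0$ with $(z,w)\in\mathcal E$ and $c\in X^+$ the relative entropy is $$H[c|\bar c^{z,w}]=\sum_{(r,s)\in\Omega}\bar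 c^{z,w}_{r,s}\Psi\Big(\frac{c_{r,s}}{\bar c^{z,w}_{r,s}}\Big)\in[0,\infty],\qquad\Psi(x)=x\ln x+1-x\ge0,\quad \Psi(0)=1.$$ *)

theory Defs
  imports "HOL-Analysis.Analysis"
begin

text \<open>
  A sequence on \<open>Omega\<close> is a function on pairs of naturals whose value at (0,0) is irrelevant:
  every sum and every pointwise condition below ranges over \<open>Omega\<close> only.
  Sums of nonnegative terms are taken in \<^typ>\<open>ennreal\<close>, so that divergence gives \<open>\<infinity>\<close>.
  The embedding \<^const>\<open>ennreal\<close> sends negative reals to 0; it is only meant to be applied here to
  sequences that are nonnegative on \<open>Omega\<close>.
\<close>

definition Omega :: "(nat \<times> nat) set" where
  "Omega = {(r, s). r + s \<ge> 1}"

definition cbar :: "(nat \<Rightarrow> nat \<Rightarrow> real) \<Rightarrow> real \<Rightarrow> real \<Rightarrow> nat \<Rightarrow> nat \<Rightarrow> real" where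
  "cbar Q z w r s = z ^ r * w ^ s * Q r s"

definition rho_of :: "(nat \<Rightarrow> nat \<Rightarrow> real) \<Rightarrow> ennreal" where
  "rho_of c = (\<Sum>\<^sub>\<infinity>(r, s)\<in>Omega. ennreal (real r * c r s))"

definition sigma_of :: "(nat \<Rightarrow> nat \<Rightarrow> real) \<Rightarrow> ennreal" where
  "sigma_of c = (\<Sum>\<^sub>\<infinity>(r, s)\<in>Omega. ennreal (real s * c r s))"

definition existence_region :: "(nat \<Rightarrow> nat \<Rightarrow> real) \<Rightarrow> (real \<times> real) set" where
  "existence_region Q =
     {(z, w). z \<ge> 0 \<and> w \<ge> 0 \<and> rho_of (cbar Q z w) + sigma_of (cbar Q z w) < \<infinity>}"

definition X_plus :: "(nat \<Rightarrow> nat \<Rightarrow> real) set" where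
  "X_plus = {c. (\<forall>(r, s)\<in>Omega. c r s \<ge> 0) \<and>
                (\<Sum>\<^sub>\<infinity>(r, s)\<in>Omega. ennreal (real (r + s) * c r s)) < \<infinity>}"

definition X_plus_mass :: "real \<Rightarrow> real \<Rightarrow> (nat \<Rightarrow> nat \<Rightarrow> real) set" where
  "X_plus_mass \<rho> \<sigma> = {c \<in> X_plus. rho_of c = ennreal \<rho> \<and> sigma_of c = ennreal \<sigma>}"

text \<open>The convention \<open>Psi 0 = 1\<close> holds because the first summand vanishes at 0.\<close>

definition Psi :: "real \<Rightarrow> real" where
  "Psi x = x * ln x + 1 - x"

definition rel_entropy :: "(nat \<Rightarrow> nat \<Rightarrow> real) \<Rightarrow> (nat \<Rightarrow> nat \<Rightarrow> real) \<Rightarrow> ennreal" where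
  "rel_entropy c d = (\<Sum>\<^sub>\<infinity>(r, s)\<in>Omega. ennreal (d r s * Psi (c r s / d r s)))"

end

theory Submission
  imports Defs
begin

text \<open>
  Put \<open>d = cbar Q z w\<close>, and let \<open>(a, b)\<close> be the mass that \<open>d\<close> lacks; the variational inequality
  makes \<open>a\<close> and \<open>b\<close> nonnegative. Adding mass of order 1 at a large cluster \<open>(r, s)\<close> needs a density
  of order \<open>1 / (r + s)\<close>, so it costs little entropy as long as \<open>d r s\<close> is not exponentially small.
  On either side of the ray through \<open>(a, b)\<close> there are such clusters whose direction is at worst
  slightly off that side: otherwise \<open>(z, w)\<close> could be moved within the region of existence in a
  direction with positive component along \<open>(a, b)\<close>, contradicting the variational inequality.
  A suitable mixture of two of these clusters supplies \<open>(a, b)\<close> up to a small error, which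
  is corrected by slightly changing the two monomer densities.
\<close>

section \<open>Passage between \<open>ennreal\<close> sums and real summability\<close>

lemma infsum_ennreal_eq:
  fixes f :: "'a \<Rightarrow> real"
  assumes "(f has_sum x) A" and "\<And>p. p \<in> A \<Longrightarrow> f p \<ge> 0"
  shows "(\<Sum>\<^sub>\<infinity>p\<in>A. ennreal (f p)) = ennreal x"
proof -
  have "(\<Sum>\<^sub>\<infinity>p\<in>A. ennreal (f p)) = (SUP F\<in>{F. finite F \<and> F \<subseteq> A}. \<Sum>p\<in>F. ennreal (f p))"
    by (rule nonneg_infsum_complete) simp
  also have "\<dots> = (SUP F\<in>{F. finite F \<and> F \<subseteq> A}. ennreal (sum f F))"
    by (intro SUP_cong sum_ennreal) (use assms(2) in auto)
  also have "\<dots> = ennreal (infsum f A)"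
    by (rule infsum_nonneg_is_SUPREMUM_ennreal[symmetric])
      (use assms in \<open>auto simp: summable_on_def\<close>)
  finally show ?thesis
    using infsumI[OF assms(1)] by simp
qed

lemma summable_on_if_infsum_ennreal_finite:
  fixes f :: "'a \<Rightarrow> real"
  assumes fin: "(\<Sum>\<^sub>\<infinity>p\<in>A. ennreal (f p)) < \<infinity>" and nn: "\<And>p. p \<in> A \<Longrightarrow> f p \<ge> 0"
  shows "f summable_on A"
proof (rule nonneg_bdd_above_summable_on[OF nn])
  let ?S = "\<Sum>\<^sub>\<infinity>p\<in>A. ennreal (f p)"
  have "sum f F \<le> enn2real ?S" if "F \<subseteq> A" "finite F" for F
  proof -
    have "ennreal (sum f F) = (\<Sum>p\<in>F. ennreal (f p))"
      by (rule sum_ennreal[symmetric]) (use nn that in auto)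
    also have "\<dots> \<le> (SUP F\<in>{F. finite F \<and> F \<subseteq> A}. \<Sum>p\<in>F. ennreal (f p))"
      by (rule SUP_upper) (use that in auto)
    also have "\<dots> = ?S"
      by (rule nonneg_infsum_complete[symmetric]) simp
    also have "\<dots> = ennreal (enn2real ?S)"
      using fin by (simp add: ennreal_enn2real_if)
    finally show ?thesis
      by (simp add: ennreal_le_iff)
  qed
  then show "bdd_above (sum f ` {F. F \<subseteq> A \<and> finite F})"
    by (auto intro!: bdd_aboveI2)
qed

lemma rho_of_eq:
  assumes "((\<lambda>(r, s). real r * c r s) has_sum x) Omega" and "\<And>r s. (r, s) \<in> Omega \<Longrightarrow> c r s \<ge> 0"
  shows "rho_of c = ennreal x"
  using infsum_ennreal_eq[OF assms(1)] assms(2) unfolding rho_of_def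
  by (auto simp: case_prod_unfold)

lemma sigma_of_eq:
  assumes "((\<lambda>(r, s). real s * c r s) has_sum x) Omega" and "\<And>r s. (r, s) \<in> Omega \<Longrightarrow> c r s \<ge> 0"
  shows "sigma_of c = ennreal x"
  using infsum_ennreal_eq[OF assms(1)] assms(2) unfolding sigma_of_def
  by (auto simp: case_prod_unfold)

section \<open>Summability in the region of existence; prescribed masses\<close>

lemma existence_region_imp_summable:
  assumes "(z, w) \<in> existence_region Q" and "\<And>r s. (r, s) \<in> Omega \<Longrightarrow> cbar Q z w r s \<ge> 0"
  shows "(\<lambda>(r, s). real r * cbar Q z w r s) summable_on Omega"
    and "(\<lambda>(r, s). real s * cbar Q z w r s) summable_on Omega"
    and "(\<lambda>(r, s). real (r + s) * cbar Q z w r s) summable_on Omega"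
proof -
  have "rho_of (cbar Q z w) < \<infinity>" "sigma_of (cbar Q z w) < \<infinity>"
    using assms(1) by (auto simp: existence_region_def ennreal_add_eq_top less_top)
  then show r: "(\<lambda>(r, s). real r * cbar Q z w r s) summable_on Omega"
    and s: "(\<lambda>(r, s). real s * cbar Q z w r s) summable_on Omega"
    unfolding rho_of_def sigma_of_def
    by (auto intro!: summable_on_if_infsum_ennreal_finite simp: case_prod_unfold assms(2))
  show "(\<lambda>(r, s). real (r + s) * cbar Q z w r s) summable_on Omega"
    using summable_on_add[OF r s] by (simp add: case_prod_unfold algebra_simps)
qed

lemma summable_imp_existence_region:
  assumes "z \<ge> 0" "w \<ge> 0" and nn: "\<And>r s. (r, s) \<in> Omega \<Longrightarrow> cbar Q z w r s \<ge> 0"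
    and "(\<lambda>(r, s). real (r + s) * cbar Q z w r s) summable_on Omega"
  shows "(z, w) \<in> existence_region Q"
proof -
  have "(\<lambda>(r, s). real r * cbar Q z w r s) summable_on Omega"
    "(\<lambda>(r, s). real s * cbar Q z w r s) summable_on Omega"
    by (rule summable_on_comparison_test[OF assms(4)];
        auto simp: nn simp del: of_nat_add intro!: mult_right_mono mult_nonneg_nonneg)+
  then have "rho_of (cbar Q z w) < \<infinity>" "sigma_of (cbar Q z w) < \<infinity>"
    by (auto simp: rho_of_eq[OF has_sum_infsum nn] sigma_of_eq[OF has_sum_infsum nn])
  then show ?thesis
    using assms(1,2) by (auto simp: existence_region_def)
qed

lemma X_plus_massI:
  assumes nn: "\<And>r s. (r, s) \<in> Omega \<Longrightarrow> c r s \<ge> 0"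
    and rho: "((\<lambda>(r, s). real r * c r s) has_sum \<rho>) Omega"
    and sigma: "((\<lambda>(r, s). real s * c r s) has_sum \<sigma>) Omega"
  shows "c \<in> X_plus_mass \<rho> \<sigma>"
proof -
  have "((\<lambda>(r, s). real (r + s) * c r s) has_sum (\<rho> + \<sigma>)) Omega"
    using has_sum_add[OF rho sigma] by (simp add: case_prod_unfold algebra_simps)
  then have "(\<Sum>\<^sub>\<infinity>(r, s)\<in>Omega. ennreal (real (r + s) * c r s)) = ennreal (\<rho> + \<sigma>)"
    using infsum_ennreal_eq[of "\<lambda>(r, s). real (r + s) * c r s" Omega "\<rho> + \<sigma>"] nn
    by (auto simp: case_prod_unfold)
  then show ?thesis
    using rho_of_eq[OF rho nn] sigma_of_eq[OF sigma nn] nn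
    by (auto simp: X_plus_mass_def X_plus_def)
qed

section \<open>Large clusters whose density is not exponentially small\<close>

text \<open>Since \<open>r + s \<le> (r + 1) * (s + 1)\<close>, a product of two differentiated
  geometric series dominates.\<close>

lemma summable_on_weighted_geometric:
  fixes x :: real
  assumes "0 \<le> x" "x < 1"
  shows "(\<lambda>(r, s). real (r + s) * x ^ (r + s)) summable_on A"
proof -
  define g where "g n = real (Suc n) * x ^ n" for n
  have "g sums (1 / (1 - x)\<^sup>2)"
    unfolding g_def using geometric_deriv_sums[of x] assms by simp
  then have g: "(g has_sum (1 / (1 - x)\<^sup>2)) UNIV"
    by (intro norm_summable_imp_has_sum)
      (use assms in \<open>auto simp: sums_iff g_def[abs_def] abs_mult\<close>)
  have "g n \<ge> 0" for n
    using assms by (simp add: g_def)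
  then have "(\<lambda>(r, s). g r * g s) summable_on UNIV \<times> UNIV"
    by (intro summable_on_SigmaI[where g = "\<lambda>r. g r * (1 / (1 - x)\<^sup>2)"])
      (auto intro: has_sum_cmult_right[OF g] summable_on_cmult_left has_sum_imp_summable[OF g]
        simp del: times_divide_eq_right)
  then have "(\<lambda>(r, s). g r * g s) summable_on A"
    by (rule summable_on_subset) auto
  then show ?thesis
  proof (rule summable_on_comparison_test)
    fix p assume "p \<in> A"
    obtain r s where p: "p = (r, s)" by fastforce
    have "real (r + s) * (x ^ r * x ^ s) \<le> (real (Suc r) * real (Suc s)) * (x ^ r * x ^ s)"
      by (rule mult_right_mono) (use assms in \<open>auto simp: algebra_simps\<close>)
    then show "(\<lambda>(r, s). real (r + s) * x ^ (r + s)) p \<le> (\<lambda>(r, s). g r * g s) p"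
      by (simp add: p g_def power_add mult_ac)
  qed (use assms in auto)
qed

text \<open>If all clusters of size at least \<open>N\<close> failed one of the two conditions, each
  term at the shifted point \<open>(u, v)\<close> would be bounded by a multiple of \<open>d\<close>
  plus a geometric term, so the shift would stay in the region of existence. The condition
  \<open>orth\<close> fixes \<open>(\<alpha>, \<beta>)\<close> up to a factor; its two signs give
  the two sides of the ray.\<close>

lemma tilted_cluster:
  fixes Q z w
  defines "d \<equiv> cbar Q z w"
  assumes Q_pos: "\<And>r s. (r, s) \<in> Omega \<Longrightarrow> Q r s > 0"
    and zw: "z > 0" "w > 0" "(z, w) \<in> existence_region Q"
    and variational: "\<And>u v. u > 0 \<Longrightarrow> v > 0 \<Longrightarrow> (u, v) \<in> existence_region Q \<Longrightarrow>
          ln (z / u) * a + ln (w / v) * b \<ge> 0"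
    and ab: "a\<^sup>2 + b\<^sup>2 > 0" and orth: "\<alpha> * a + \<beta> * b = 0" and eps: "\<epsilon> > 0"
  obtains r s where "r + s \<ge> N" "exp (- \<epsilon> * real (r + s)) \<le> d r s"
    "\<alpha> * real r + \<beta> * real s \<ge> - \<epsilon> * real (r + s)"
proof -
  \<comment> \<open>This size keeps the tilt's contribution to the exponent below
    \<open>\<epsilon> * (r + s)\<close>, the margin available to clusters on the wrong side.\<close>
  define \<eta> where "\<eta> = \<epsilon> / (1 + \<bar>a\<bar> + \<bar>b\<bar>)"
  have \<eta>: "\<eta> > 0" "\<eta> * \<bar>a\<bar> \<le> \<epsilon>" "\<eta> * \<bar>b\<bar> \<le> \<epsilon>"
    using eps by (auto simp: \<eta>_def field_simps intro!: add_pos_nonneg)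
  \<comment> \<open>Tilting \<open>(\<alpha>, \<beta>)\<close> slightly towards \<open>(a, b)\<close> gives the forbidden direction of motion.\<close>
  define \<xi> where "\<xi> = \<alpha> + \<eta> * a"
  define \<zeta> where "\<zeta> = \<beta> + \<eta> * b"
  \<comment> \<open>The shift then multiplies densities by at most
    \<open>exp (\<epsilon> / 2 * (r + s))\<close>, half the rate at which exponentially small
    densities decay.\<close>
  define \<delta> where "\<delta> = \<epsilon> / (2 * (1 + \<bar>\<xi>\<bar> + \<bar>\<zeta>\<bar>))"
  have \<delta>: "\<delta> > 0" "\<delta> * \<bar>\<xi>\<bar> \<le> \<epsilon> / 2" "\<delta> * \<bar>\<zeta>\<bar> \<le> \<epsilon> / 2"
    using eps by (auto simp: \<delta>_def field_simps intro!: add_pos_nonneg)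
  define u where "u = z * exp (\<delta> * \<xi>)"
  define v where "v = w * exp (\<delta> * \<zeta>)"
  have uv: "u > 0" "v > 0"
    using zw by (auto simp: u_def v_def)
  have d_pos: "d r s > 0" if "(r, s) \<in> Omega" for r s
    using Q_pos[OF that] zw by (simp add: d_def cbar_def)
  have cbar_uv: "cbar Q u v r s = d r s * exp (\<delta> * (\<xi> * real r + \<zeta> * real s))" for r s
    by (simp add: d_def cbar_def u_def v_def power_mult_distrib exp_add algebra_simps
        flip: exp_of_nat_mult)
  \<comment> \<open>By \<open>orth\<close> the \<open>(\<alpha>, \<beta>)\<close> part drops out of
    the variational expression, and the tilt leaves a strictly negative multiple of
    \<open>a\<^sup>2 + b\<^sup>2\<close>.\<close>
  have "(u, v) \<notin> existence_region Q"
  proof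
    assume "(u, v) \<in> existence_region Q"
    from variational[OF uv this] have "- (\<delta> * \<xi>) * a + - (\<delta> * \<zeta>) * b \<ge> 0"
      using zw by (simp add: u_def v_def ln_div ln_mult)
    also have "- (\<delta> * \<xi>) * a + - (\<delta> * \<zeta>) * b
        = - \<delta> * (\<alpha> * a + \<beta> * b) - \<delta> * \<eta> * (a\<^sup>2 + b\<^sup>2)"
      by (simp add: \<xi>_def \<zeta>_def algebra_simps power2_eq_square)
    also have "\<dots> < 0"
      using \<delta> \<eta> ab orth by simp
    finally show False by simp
  qed
  moreover have "(u, v) \<in> existence_region Q"
    if small: "\<And>r s. r + s \<ge> N \<Longrightarrow> d r s < exp (- \<epsilon> * real (r + s)) \<or>
            \<alpha> * real r + \<beta> * real s < - \<epsilon> * real (r + s)"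
  proof (rule summable_imp_existence_region)
    define C where "C = exp (\<epsilon> / 2 * real N)"
    define x where "x = exp (- (\<epsilon> / 2))"
    have C: "C \<ge> 1" using eps by (simp add: C_def)
    have x: "0 \<le> x" "x < 1" using eps by (auto simp: x_def)
    \<comment> \<open>The factor \<open>C\<close> covers the clusters smaller than \<open>N\<close>
      and those on the wrong side, whose exponent is nonpositive; the geometric term covers those
      with exponentially small density.\<close>
    have bound: "cbar Q u v r s \<le> C * d r s + x ^ (r + s)" if "(r, s) \<in> Omega" for r s
    proof -
      let ?n = "real (r + s)"
      have "\<delta> * (\<xi> * real r + \<zeta> * real s) = (\<delta> * \<xi>) * real r + (\<delta> * \<zeta>) * real s"
        by (simp add: algebra_simps)
      also have "\<dots> \<le> (\<delta> * \<bar>\<xi>\<bar>) * real r + (\<delta> * \<bar>\<zeta>\<bar>) * real s"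
        using \<delta>(1) by (intro add_mono mult_right_mono mult_left_mono) auto
      also have "\<dots> \<le> \<epsilon> / 2 * real r + \<epsilon> / 2 * real s"
        by (intro add_mono mult_right_mono \<delta>) auto
      finally have expo: "\<delta> * (\<xi> * real r + \<zeta> * real s) \<le> \<epsilon> / 2 * ?n"
        by (simp add: algebra_simps)
      consider "r + s < N" | "d r s < exp (- \<epsilon> * ?n)"
        | "\<alpha> * real r + \<beta> * real s < - \<epsilon> * ?n"
        using small[of r s] by linarith
      then show ?thesis
      proof cases
        case 1
        have "exp (\<delta> * (\<xi> * real r + \<zeta> * real s)) \<le> C"
          unfolding C_def exp_le_cancel_iff
          by (rule order_trans[OF expo]) (use 1 eps in \<open>auto intro!: mult_left_mono\<close>)
        then have "cbar Q u v r s \<le> C * d r s"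
          using d_pos[OF that] by (simp add: cbar_uv)
        then show ?thesis using x by (smt (verit) zero_le_power)
      next
        case 2
        have "cbar Q u v r s \<le> exp (- \<epsilon> * ?n) * exp (\<epsilon> / 2 * ?n)"
          unfolding cbar_uv using 2 d_pos[OF that] expo by (intro mult_mono) auto
        also have "\<dots> = x ^ (r + s)"
          by (simp add: x_def flip: exp_add exp_of_nat_mult)
        finally show ?thesis using C d_pos[OF that] by (smt (verit) mult_pos_pos)
      next
        case 3
        have "(\<eta> * a) * real r + (\<eta> * b) * real s \<le> (\<eta> * \<bar>a\<bar>) * real r + (\<eta> * \<bar>b\<bar>) * real s"
          using \<eta>(1) by (intro add_mono mult_right_mono mult_left_mono) auto
        also have "\<dots> \<le> \<epsilon> * real r + \<epsilon> * real s"
          by (intro add_mono mult_right_mono \<eta>) auto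
        finally have "\<xi> * real r + \<zeta> * real s \<le> 0"
          using 3 by (simp add: \<xi>_def \<zeta>_def algebra_simps)
        then have "exp (\<delta> * (\<xi> * real r + \<zeta> * real s)) \<le> C"
          using C \<delta>(1) by (smt (verit) exp_le_one_iff mult_nonneg_nonpos)
        then have "cbar Q u v r s \<le> C * d r s"
          using d_pos[OF that] by (simp add: cbar_uv)
        then show ?thesis using x by (smt (verit) zero_le_power)
      qed
    qed
    have "(\<lambda>(r, s). real (r + s) * d r s) summable_on Omega"
      using existence_region_imp_summable(3)[OF zw(3)] d_pos
      by (simp add: d_def less_imp_le)
    then have "(\<lambda>p. C * (\<lambda>(r, s). real (r + s) * d r s) p
        + (\<lambda>(r, s). real (r + s) * x ^ (r + s)) p) summable_on Omega"
      by (intro summable_on_add summable_on_cmult_right summable_on_weighted_geometric x)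
    then show "(\<lambda>(r, s). real (r + s) * cbar Q u v r s) summable_on Omega"
    proof (rule summable_on_comparison_test)
      fix p assume p: "p \<in> Omega"
      obtain r s where rs: "p = (r, s)" by fastforce
      show "(\<lambda>(r, s). real (r + s) * cbar Q u v r s) p
          \<le> C * (\<lambda>(r, s). real (r + s) * d r s) p + (\<lambda>(r, s). real (r + s) * x ^ (r + s)) p"
        using mult_left_mono[OF bound[of r s], of "real (r + s)"] p
        by (simp add: rs algebra_simps)
      show "0 \<le> (\<lambda>(r, s). real (r + s) * cbar Q u v r s) p"
        using p d_pos[of r s] by (simp add: rs cbar_uv)
    qed
    show "0 \<le> cbar Q u v r s" if "(r, s) \<in> Omega" for r s
      using d_pos[OF that] by (simp add: cbar_uv)
  qed (use uv in auto)
  ultimately show ?thesis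
    using that by (meson not_less)
qed

section \<open>Entropy cost of a perturbation\<close>

lemma Psi_nonneg:
  assumes "x \<ge> 0"
  shows "Psi x \<ge> 0"
proof (cases "x = 0")
  case False
  then have "ln (1 / x) \<le> 1 / x - 1"
    using assms by (intro ln_le_minus_one) auto
  then have "x * ln (1 / x) \<le> x * (1 / x - 1)"
    using assms by (rule mult_left_mono)
  then show ?thesis
    using assms False by (simp add: Psi_def ln_div algebra_simps)
qed (simp add: Psi_def)

text \<open>Follows from \<open>ln x \<le> x - 1\<close>. It makes the cost quadratic in the change
  where the density is bounded below, as for the monomers.\<close>

lemma Psi_le_square:
  assumes "x \<ge> 0"
  shows "Psi x \<le> (x - 1)\<^sup>2"
proof (cases "x = 0")
  case False
  then have "x * ln x \<le> x * (x - 1)"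
    using assms by (intro mult_left_mono ln_le_minus_one) auto
  then show ?thesis
    by (simp add: Psi_def power2_eq_square algebra_simps)
qed (simp add: Psi_def)

text \<open>The left side equals \<open>(D + f) * ln ((D + f) / D) - f\<close>. As
  \<open>D * ln (1 + f / D) \<le> f\<close>, only \<open>f * ln ((D + f) / D)\<close> remains. The
  logarithm may grow like \<open>\<epsilon> * n\<close>, but \<open>f \<le> S / n\<close> cancels
  this growth.\<close>

lemma Psi_perturb_le:
  fixes D f \<epsilon> n :: real
  assumes "0 < D" "D \<le> M" "0 \<le> f" "f \<le> S / n" "exp (- \<epsilon> * n) \<le> D" "n \<ge> 1" "\<epsilon> > 0" "S > 0"
  shows "D * Psi ((D + f) / D) \<le> S / n * ln (1 + M + S) + S * \<epsilon>"
proof -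
  have "S / n \<le> S"
    using assms(6,8) by (simp add: field_simps)
  then have le: "D + f \<le> 1 + M + S"
    using assms by linarith
  have "- \<epsilon> * n \<le> ln D"
    using assms(1,5) by (simp add: ln_ge_iff)
  moreover have "ln (D + f) \<le> ln (1 + M + S)"
    using le assms by (intro ln_mono) auto
  moreover have "ln ((D + f) / D) = ln (D + f) - ln D"
    using assms by (simp add: ln_div)
  ultimately have ln: "ln ((D + f) / D) \<le> ln (1 + M + S) + \<epsilon> * n"
    by linarith
  have "D * ln ((D + f) / D) \<le> D * (f / D)"
  proof (rule mult_left_mono)
    have "ln (1 + f / D) \<le> f / D"
      using assms by (intro ln_add_one_self_le_self) auto
    then show "ln ((D + f) / D) \<le> f / D"
      using assms by (simp add: add_divide_distrib)
  qed (use assms in auto)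
  then have "D * Psi ((D + f) / D) \<le> f * ln ((D + f) / D)"
    using assms(1) by (simp add: Psi_def field_simps)
  also have "\<dots> \<le> f * (ln (1 + M + S) + \<epsilon> * n)"
    using ln assms by (intro mult_left_mono) auto
  also have "\<dots> \<le> S / n * (ln (1 + M + S) + \<epsilon> * n)"
    using assms by (intro mult_right_mono add_nonneg_nonneg) auto
  also have "\<dots> = S / n * ln (1 + M + S) + S * \<epsilon>"
    using assms by (simp add: field_simps)
  finally show ?thesis .
qed

section \<open>Mixing, point masses and monotonicity of the region\<close>

text \<open>Either one endpoint already lies within \<open>\<epsilon>\<close> of 0, or the endpoints
  have opposite signs and some mixture is exactly 0.\<close>

lemma convex_combination_near_zero:
  fixes x y \<epsilon> :: real
  assumes "x \<ge> - \<epsilon>" "y \<le> \<epsilon>" "\<epsilon> > 0"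
  obtains t where "0 \<le> t" "t \<le> 1" "\<bar>t * x + (1 - t) * y\<bar> \<le> \<epsilon>"
proof -
  consider "x \<le> \<epsilon>" | "y \<ge> - \<epsilon>" | "x > \<epsilon>" "y < - \<epsilon>" by linarith
  then show ?thesis
  proof cases
    case 3
    then have "(- y / (x - y)) * x + (1 - (- y / (x - y))) * y = 0"
      using assms by (simp add: field_simps)
    then show ?thesis
      using 3 assms by (intro that[of "- y / (x - y)"]) (auto simp: field_simps)
  qed (use assms that[of 1] that[of 0] in auto)
qed

lemma has_sum_point:
  fixes h :: "'a \<Rightarrow> real"
  assumes "q \<in> A"
  shows "((\<lambda>p. h p * (if p = q then t else 0)) has_sum (h q * t)) A"
  by (rule has_sum_finite_neutralI[of "{q}"]) (use assms in auto)

text \<open>Decreasing either argument decreases every term. This supplies the test points that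
  determine the signs of the missing masses.\<close>

lemma existence_region_downward:
  assumes Q_pos: "\<And>r s. (r, s) \<in> Omega \<Longrightarrow> Q r s > 0"
    and "(z, w) \<in> existence_region Q" "0 \<le> u" "u \<le> z" "0 \<le> v" "v \<le> w"
  shows "(u, v) \<in> existence_region Q"
proof (rule summable_imp_existence_region)
  have nn: "cbar Q x y r s \<ge> 0" if "(r, s) \<in> Omega" "x \<ge> 0" "y \<ge> 0" for r s x y
    using that Q_pos by (auto simp: cbar_def less_imp_le)
  have le: "cbar Q u v r s \<le> cbar Q z w r s" if "(r, s) \<in> Omega" for r s
    unfolding cbar_def using assms less_imp_le[OF Q_pos[OF that]]
    by (intro mult_mono power_mono) auto
  have "(\<lambda>(r, s). real (r + s) * cbar Q z w r s) summable_on Omega"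
    using existence_region_imp_summable(3)[OF assms(2)] nn assms by simp
  then show "(\<lambda>(r, s). real (r + s) * cbar Q u v r s) summable_on Omega"
    by (rule summable_on_comparison_test)
      (use assms in \<open>auto simp: nn le intro!: mult_left_mono mult_nonneg_nonneg\<close>)+
  show "0 \<le> cbar Q u v r s" if "(r, s) \<in> Omega" for r s
    using nn[OF that] assms by simp
qed (use assms in auto)

section \<open>Construction of competitors with small entropy\<close>

theorem theorem4p3:
  fixes Q :: "nat \<Rightarrow> nat \<Rightarrow> real" and \<rho> \<sigma> z w :: real
  assumes Q_pos: "\<And>r s. (r, s) \<in> Omega \<Longrightarrow> Q r s > 0"
    and Q_monomers: "Q 1 0 = 1" "Q 0 1 = 1"
    and region_nontrivial: "\<exists>u v. u > 0 \<and> v > 0 \<and> (u, v) \<in> existence_region Q"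
    and mass_pos: "\<rho> > 0" "\<sigma> > 0"
    and zw: "z > 0" "w > 0" "(z, w) \<in> existence_region Q"
    and variational: "\<And>u v. u > 0 \<Longrightarrow> v > 0 \<Longrightarrow> (u, v) \<in> existence_region Q \<Longrightarrow>
          ln (z / u) * (\<rho> - enn2real (rho_of (cbar Q z w)))
        + ln (w / v) * (\<sigma> - enn2real (sigma_of (cbar Q z w))) \<ge> 0"
  shows "(INF c\<in>X_plus_mass \<rho> \<sigma>. rel_entropy c (cbar Q z w)) = 0"
proof -
  define d where "d = cbar Q z w"
  define a where "a = \<rho> - enn2real (rho_of d)"
  define b where "b = \<sigma> - enn2real (sigma_of d)"
  define S where "S = a + b"
  have var: "ln (z / u) * a + ln (w / v) * b \<ge> 0"
    if "u > 0" "v > 0" "(u, v) \<in> existence_region Q" for u v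
    using variational[OF that] by (simp add: a_def b_def d_def)
  have d_pos: "d r s > 0" if "(r, s) \<in> Omega" for r s
    using Q_pos[OF that] zw by (simp add: d_def cbar_def)
  have d_mono: "d 1 0 = z" "d 0 1 = w"
    using Q_monomers by (simp_all add: d_def cbar_def)
  note d_nn = less_imp_le[OF d_pos]
  note summable = existence_region_imp_summable[OF zw(3), folded d_def, OF d_nn]
  \<comment> \<open>Every single density is at most \<open>M\<close>, because the weight
    \<open>r + s\<close> is at least 1 on \<open>Omega\<close>.\<close>
  define M where "M = (\<Sum>\<^sub>\<infinity>(r, s)\<in>Omega. real (r + s) * d r s)"
  have d_le_M: "d r s \<le> M" if "(r, s) \<in> Omega" for r s
  proof -
    have "1 * d r s \<le> real (r + s) * d r s"
      by (rule mult_right_mono) (use that d_nn[OF that] in \<open>auto simp: Omega_def\<close>)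
    also have "\<dots> \<le> M"
      using finite_sum_le_infsum[OF summable(3), of "{(r, s)}"] that d_nn
      by (auto simp: M_def)
    finally show ?thesis by simp
  qed
  have rho_d: "((\<lambda>(r, s). real r * d r s) has_sum (\<rho> - a)) Omega"
  proof -
    \<comment> \<open>Nonnegativity lets \<open>enn2real\<close> undo \<open>ennreal\<close>, which
      would send a negative sum to 0.\<close>
    have "(\<Sum>\<^sub>\<infinity>(r, s)\<in>Omega. real r * d r s) \<ge> 0"
      by (intro infsum_nonneg) (auto simp: d_nn)
    then show ?thesis
      using has_sum_infsum[OF summable(1)] rho_of_eq[OF has_sum_infsum[OF summable(1)] d_nn]
      by (simp add: a_def)
  qed
  have sigma_d: "((\<lambda>(r, s). real s * d r s) has_sum (\<sigma> - b)) Omega"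
  proof -
    have "(\<Sum>\<^sub>\<infinity>(r, s)\<in>Omega. real s * d r s) \<ge> 0"
      by (intro infsum_nonneg) (auto simp: d_nn)
    then show ?thesis
      using has_sum_infsum[OF summable(2)] sigma_of_eq[OF has_sum_infsum[OF summable(2)] d_nn]
      by (simp add: b_def)
  qed
  \<comment> \<open>Halving one coordinate leaves just \<open>ln 2 * a\<close> or
    \<open>ln 2 * b\<close> in the variational inequality.\<close>
  have "(z / 2, w) \<in> existence_region Q" "(z, w / 2) \<in> existence_region Q"
    using zw by (auto intro!: existence_region_downward[OF Q_pos zw(3)])
  then have "ln (z / (z / 2)) * a + ln (w / w) * b \<ge> 0" "ln (z / z) * a + ln (w / (w / 2)) * b \<ge> 0"
    by (intro var; use zw in simp)+
  then have ab: "a \<ge> 0" "b \<ge> 0"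
    using zw by (auto simp: zero_le_mult_iff)
  have "\<exists>c\<in>X_plus_mass \<rho> \<sigma>. rel_entropy c d \<le> ennreal \<kappa>" if \<kappa>: "\<kappa> > 0" for \<kappa>
  proof (cases "S = 0")
    case True
    then have "a = 0" "b = 0" using ab by (auto simp: S_def)
    then have "d \<in> X_plus_mass \<rho> \<sigma>"
      using X_plus_massI[OF d_nn rho_d sigma_d] by simp
    moreover have "rel_entropy d d = 0"
      unfolding rel_entropy_def
      by (rule infsum_0) (use d_pos in \<open>force simp: Psi_def\<close>)
    ultimately show ?thesis by (intro bexI[of _ d]) auto
  next
    case False
    then have S: "S > 0" and ab2: "a\<^sup>2 + b\<^sup>2 > 0"
      using ab by (auto simp: S_def sum_power2_gt_zero_iff)
    \<comment> \<open>The final cost is at most \<open>4 * S * \<epsilon>\<close> for the two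
      clusters plus \<open>2 * \<epsilon>\<close> for the monomers. The bounds by \<open>z\<close>
      and \<open>w\<close> keep the corrected monomer densities nonnegative.\<close>
    define \<epsilon> where "\<epsilon> = min (\<kappa> / (4 * S + 2)) (min z w)"
    have \<epsilon>: "\<epsilon> > 0" "\<epsilon> \<le> z" "\<epsilon> \<le> w" "(4 * S + 2) * \<epsilon> \<le> \<kappa>"
    proof -
      show "(4 * S + 2) * \<epsilon> \<le> \<kappa>"
        using S mult_left_mono[of \<epsilon> "\<kappa> / (4 * S + 2)" "4 * S + 2"] by (simp add: \<epsilon>_def)
    qed (use zw \<kappa> S in \<open>auto simp: \<epsilon>_def\<close>)
    \<comment> \<open>From size \<open>N\<close> on, the term \<open>S / n * ln (1 + M + S)\<close>
      is at most \<open>S * \<epsilon>\<close>. The bound 2 keeps the chosen clusters distinct from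
      the monomers.\<close>
    obtain N :: nat where N: "real N \<ge> ln (1 + M + S) / \<epsilon>" "N \<ge> 2"
      using real_arch_simple[of "max 2 (ln (1 + M + S) / \<epsilon>)"] by auto
    note cluster = tilted_cluster[OF Q_pos zw var ab2 _ \<epsilon>(1), where N = N, folded d_def]
    \<comment> \<open>The vectors \<open>(b, - a)\<close> and \<open>(- b, a)\<close> are the two
      opposite normals to the ray through \<open>(a, b)\<close>.\<close>
    obtain r1 s1 where c1: "r1 + s1 \<ge> N" "exp (- \<epsilon> * real (r1 + s1)) \<le> d r1 s1"
      "b * real r1 + (- a) * real s1 \<ge> - \<epsilon> * real (r1 + s1)"
      using cluster[of b "- a"] by (auto simp: mult.commute)
    obtain r2 s2 where c2: "r2 + s2 \<ge> N" "exp (- \<epsilon> * real (r2 + s2)) \<le> d r2 s2"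
      "(- b) * real r2 + a * real s2 \<ge> - \<epsilon> * real (r2 + s2)"
      using cluster[of "- b" a] by (auto simp: mult.commute)
    define n1 where "n1 = real (r1 + s1)"
    define n2 where "n2 = real (r2 + s2)"
    have n: "n1 \<ge> real N" "n2 \<ge> real N" "n1 \<ge> 2" "n2 \<ge> 2"
      using c1 c2 N by (simp_all add: n1_def n2_def)
    have in_Omega: "(r1, s1) \<in> Omega" "(r2, s2) \<in> Omega" "(1, 0) \<in> Omega" "(0, 1) \<in> Omega"
      using c1 c2 N by (auto simp: Omega_def)
    define x1 where "x1 = (b * real r1 - a * real s1) / n1"
    define x2 where "x2 = (b * real r2 - a * real s2) / n2"
    have "x1 \<ge> - \<epsilon>" "x2 \<le> \<epsilon>"
      using c1(3) c2(3) n unfolding n1_def[symmetric] n2_def[symmetric]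
      by (simp_all add: x1_def x2_def field_simps)
    then obtain t where t: "0 \<le> t" "t \<le> 1" "\<bar>t * x1 + (1 - t) * x2\<bar> \<le> \<epsilon>"
      using convex_combination_near_zero \<epsilon>(1) by metis
    \<comment> \<open>\<open>x1\<close> and \<open>x2\<close> are the excesses of \<open>S * r / (r + s)\<close> over \<open>a\<close>, so the mixture supplies the
      masses \<open>a + e\<close> and \<open>b - e\<close>. The two clusters may coincide.\<close>
    define e where "e = t * x1 + (1 - t) * x2"
    \<comment> \<open>Dividing by the cluster size makes the first cluster carry total mass
      \<open>S * t\<close> and the second \<open>S * (1 - t)\<close>.\<close>
    define t1 where "t1 = S * t / n1"
    define t2 where "t2 = S * (1 - t) / n2"
    \<comment> \<open>Additive point masses, unlike function updates, accumulate correctly when the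
      two clusters coincide.\<close>
    define \<delta> :: "nat \<times> nat \<Rightarrow> real \<Rightarrow> nat \<times> nat \<Rightarrow> real"
      where "\<delta> q y p = (if p = q then y else 0)" for q y p
    define c where "c r s = d r s + \<delta> (r1, s1) t1 (r, s) + \<delta> (r2, s2) t2 (r, s)
      + \<delta> (1, 0) (- e) (r, s) + \<delta> (0, 1) e (r, s)" for r s
    have shares: "S * real r1 / n1 = a + x1" "S * real r2 / n2 = a + x2"
      "S * real s1 / n1 = b - x1" "S * real s2 / n2 = b - x2"
      using n by (simp_all add: S_def x1_def x2_def field_simps n1_def n2_def)
    have mass: "((\<lambda>p. h p * c (fst p) (snd p)) has_sum
        (m + h (r1, s1) * t1 + h (r2, s2) * t2 + h (1, 0) * (- e) + h (0, 1) * e)) Omega"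
      if "((\<lambda>p. h p * d (fst p) (snd p)) has_sum m) Omega" for h m
      unfolding c_def distrib_left \<delta>_def prod.collapse
      by (intro has_sum_add has_sum_point that in_Omega)
    have "real r1 * t1 + real r2 * t2 = t * (S * real r1 / n1) + (1 - t) * (S * real r2 / n2)"
      by (simp add: t1_def t2_def mult_ac)
    also have "\<dots> = a + e"
      unfolding shares by (simp add: e_def algebra_simps)
    finally have rho_c: "((\<lambda>(r, s). real r * c r s) has_sum \<rho>) Omega"
      using mass[of "\<lambda>p. real (fst p)" "\<rho> - a"] rho_d
      by (simp add: case_prod_unfold algebra_simps)
    have "real s1 * t1 + real s2 * t2
        = t * (S * real s1 / n1) + (1 - t) * (S * real s2 / n2)"
      by (simp add: t1_def t2_def mult_ac)
    then have "real s1 * t1 + real s2 * t2 = b - e"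
      unfolding shares by (simp add: e_def algebra_simps)
    then have sigma_c: "((\<lambda>(r, s). real s * c r s) has_sum \<sigma>) Omega"
      using mass[of "\<lambda>p. real (snd p)" "\<sigma> - b"] sigma_d
      by (simp add: case_prod_unfold algebra_simps)
    have t_nn: "t1 \<ge> 0" "t2 \<ge> 0"
      using t S n by (auto simp: t1_def t2_def)
    have e: "\<bar>e\<bar> \<le> \<epsilon>"
      using t(3) by (simp add: e_def)
    have large: "(r1, s1) \<noteq> (1, 0)" "(r1, s1) \<noteq> (0, 1)" "(r2, s2) \<noteq> (1, 0)" "(r2, s2) \<noteq> (0, 1)"
      using c1 c2 N by auto
    have c_mono: "c 1 0 = z - e" "c 0 1 = w + e"
      using large by (auto simp: c_def \<delta>_def d_mono simp flip: One_nat_def)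
    have c_other: "c r s \<ge> d r s" if "(r, s) \<noteq> (1, 0)" "(r, s) \<noteq> (0, 1)" for r s
      using that t_nn by (auto simp: c_def \<delta>_def)
    have c_nn: "c r s \<ge> 0" if "(r, s) \<in> Omega" for r s
    proof (cases "(r, s) = (1, 0) \<or> (r, s) = (0, 1)")
      case True
      then show ?thesis using c_mono e \<epsilon> by auto
    next
      case False
      then show ?thesis using c_other[of r s] d_nn[OF that] by auto
    qed
    have "c \<in> X_plus_mass \<rho> \<sigma>"
      by (rule X_plus_massI[OF c_nn rho_c sigma_c])
    moreover have "rel_entropy c d \<le> ennreal \<kappa>"
    proof -
      define g where "g = (\<lambda>(r, s). d r s * Psi (c r s / d r s))"
      define F where "F = {(r1, s1), (r2, s2)}"
      define G where "G = {(1, 0), (0, 1) :: nat \<times> nat}"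
      have g_nn: "g p \<ge> 0" if "p \<in> Omega" for p
        using that by (auto simp: g_def case_prod_unfold
            intro!: mult_nonneg_nonneg Psi_nonneg d_nn c_nn divide_nonneg_nonneg)
      \<comment> \<open>Elsewhere \<open>c\<close> equals \<open>d\<close>, and
        \<open>Psi 1 = 0\<close>.\<close>
      have "(g has_sum sum g (F \<union> G)) Omega"
      proof (rule has_sum_finite_neutralI)
        fix p assume "p \<in> Omega - (F \<union> G)"
        then show "g p = 0"
          using d_pos[of "fst p" "snd p"]
          by (cases p) (auto simp: g_def c_def \<delta>_def F_def G_def Psi_def)
      qed (use in_Omega in \<open>auto simp: F_def G_def\<close>)
      then have "rel_entropy c d = ennreal (sum g (F \<union> G))"
        using infsum_ennreal_eq[OF _ g_nn] by (simp add: rel_entropy_def g_def case_prod_unfold)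
      moreover have "sum g (F \<union> G) \<le> \<kappa>"
      proof -
        have cost: "g (r, s) \<le> 2 * S * \<epsilon>"
          if "(r, s) \<in> F" for r s
        proof -
          let ?n = "real (r + s)"
          have rs: "(r, s) \<in> Omega" "exp (- \<epsilon> * ?n) \<le> d r s" "?n \<ge> real N"
            using that c1 c2 in_Omega by (auto simp: F_def)
          define f where "f = \<delta> (r1, s1) t1 (r, s) + \<delta> (r2, s2) t2 (r, s)"
          have c_eq: "c r s = d r s + f"
            using that large by (auto simp: F_def c_def \<delta>_def f_def)
          have "f \<ge> 0"
            using t_nn by (simp add: f_def \<delta>_def)
          have "t1 \<le> S / n1" "t2 \<le> S / n2"
            using t S n by (auto simp: t1_def t2_def divide_simps mult_left_le)
          \<comment> \<open>This is for coinciding clusters, where both increments land at the same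
            place.\<close>
          moreover have "t1 + t2 = S / n1" if "n1 = n2"
            using that n by (simp add: t1_def t2_def field_simps)
          ultimately have "f \<le> S / ?n"
            using that by (auto simp: f_def \<delta>_def F_def n1_def n2_def)
          then have "g (r, s) \<le> S / ?n * ln (1 + M + S) + S * \<epsilon>"
            unfolding g_def prod.case c_eq
            using rs N \<epsilon>(1) S \<open>f \<ge> 0\<close> by (intro Psi_perturb_le d_pos d_le_M) auto
          also have "S / ?n * ln (1 + M + S) \<le> S * \<epsilon>"
          proof -
            have "ln (1 + M + S) \<le> \<epsilon> * real N"
              using N(1) \<epsilon>(1) by (simp add: field_simps)
            also have "\<dots> \<le> \<epsilon> * ?n"
              using rs(3) \<epsilon>(1) by (intro mult_left_mono) auto
            finally have "S / ?n * ln (1 + M + S) \<le> S / ?n * (\<epsilon> * ?n)"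
              using S by (intro mult_left_mono) auto
            also have "\<dots> = S * \<epsilon>"
              using rs(3) N by simp
            finally show ?thesis .
          qed
          finally show ?thesis by simp
        qed
        \<comment> \<open>The quadratic bound gives \<open>e\<^sup>2 / y\<close>, and
          \<open>\<bar>e\<bar> \<le> \<epsilon> \<le> y\<close> turns this into at most
          \<open>\<epsilon>\<close>.\<close>
        have monomer_cost: "y * Psi (x / y) \<le> \<epsilon>"
          if "y \<ge> \<epsilon>" "\<bar>x - y\<bar> = \<bar>e\<bar>" "x \<ge> 0" for x y
        proof -
          have y: "y > 0" using that \<epsilon> by simp
          have "y * Psi (x / y) \<le> y * (x / y - 1)\<^sup>2"
            using that y by (intro mult_left_mono Psi_le_square) auto
          also have "\<dots> = \<bar>e\<bar> * \<bar>e\<bar> / y"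
            using y that(2)[symmetric] by (simp add: field_simps power2_eq_square)
          also have "\<dots> \<le> \<epsilon> * \<epsilon> / \<epsilon>"
            using e that(1) \<epsilon>(1) by (intro frac_le mult_mono) auto
          finally show ?thesis using \<epsilon>(1) by simp
        qed
        have "sum g G = g (1, 0) + g (0, 1)"
          by (simp add: G_def)
        also have "\<dots> \<le> \<epsilon> + \<epsilon>"
          unfolding g_def prod.case c_mono d_mono
          using e \<epsilon> by (intro add_mono monomer_cost) auto
        finally have G: "sum g G \<le> 2 * \<epsilon>" by simp
        have "sum g F \<le> real (card F) * (2 * S * \<epsilon>)"
          by (rule sum_bounded_above) (metis cost surj_pair)
        also have "\<dots> \<le> 2 * (2 * S * \<epsilon>)"
        proof (rule mult_right_mono)
          show "real (card F) \<le> 2"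
            by (cases "(r1, s1) = (r2, s2)") (simp_all add: F_def)
        qed (use S \<epsilon>(1) in simp)
        finally have F: "sum g F \<le> 4 * S * \<epsilon>" by simp
        have "sum g (F \<union> G) = sum g F + sum g G"
          by (rule sum.union_disjoint) (use large in \<open>auto simp: F_def G_def\<close>)
        also have "\<dots> \<le> (4 * S + 2) * \<epsilon>"
          using F G by (simp add: algebra_simps)
        finally show ?thesis using \<epsilon>(4) by linarith
      qed
      ultimately show ?thesis by (simp add: ennreal_leI)
    qed
    ultimately show ?thesis by blast
  qed
  then have "(INF c\<in>X_plus_mass \<rho> \<sigma>. rel_entropy c d) \<le> 0 + ennreal \<kappa>" if "\<kappa> > 0" for \<kappa>
    unfolding add_0 using that by (blast intro: INF_lower2)
  then have "(INF c\<in>X_plus_mass \<rho> \<sigma>. rel_entropy c d) \<le> 0"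
    by (rule ennreal_le_epsilon)
  then show ?thesis by (simp add: d_def)
qed

end
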